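(* Let $M:\{1,\dots,m\}\to\mathbb{Z}_{\ge 0}$ have exactly $n$ non-zero entries, let $0<\alpha<1$, and let $\tau>0$. Let $S_{\mathrm{lab}}$ be the random summary produced by the laborious approach under threshold sampling with parameter $\tau$, and let $S_{\mathrm{short}}$ be the random summary produced by Algorithm THRESHOLD with parameter $\tau$ (both defined in the context). Then $S_{\mathrm{short}}$ and $S_{\mathrm{lab}}$ have the same probability distribution.
   Context: A summary is a finite set of pairs $(i,v)$ with $i\in\{1,\dots,m\}$ and $v$ a value, with at most one pair for each $i$. Geometric noise with parameter $\alpha$: an integer random variable $X$ with $\Pr[X=x]=\frac{1-\alpha}{1+\alpha}\alpha^{|x|}$ for all $x\in\mathbb{Z}$. (In the application, $\alpha=e^{-\epsilon/\Delta}$, where $\epsilon$ is the differential privacy parameter and $\Delta$ the sensitivity.) Laborious approach under threshold sampling: for every $i\in\{1,\dots,m\}$ independently, set $M'(i)=M(i)+X_i$ with $X_i$ geometric noise with parameter $\alpha$. Then, independently for each $i$ given $M'$, include $(i,M'(i))$ in the summary with probability $\min\left(\frac{|M'(i)|}{\tau},1\right)$. Algorithm THRESHOLD: 1. For every $i$ with $M(i)\ne 0$, independently add geometric noise with parameter $\alpha$ to $M(i)$ to get $M'(i)$, and add $(i,M'(i))$ to the summary with probability $\min\left(\frac{|M'(i)|}{\tau},1\right)$. 2. For the zero entries, sample (independently) $k$ from the binomial distribution $\mathrm{Bin}(m-n,p_\tau)$, where $p_\tau=\frac{2\alpha(1-\alpha^\tau)}{\tau(1-\alpha^2)}$. 3.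 Select uniformly at random $k$ distinct locations $i$ with $M(i)=0$. For each of these, independently draw a value $v$ from the distribution $$\Pr[X\le\nu]=\begin{cases}\tau\alpha^{-\nu}C_\tau(1-\alpha), & \nu\le-\tau,\\ C_\tau\left(-\nu\alpha^{-\nu}+(\nu+1)\alpha^{-\nu+1}-\alpha^{\tau+1}\right), & -\tau<\nu\le 0,\\ \frac12+\alpha C_\tau\left(1-(\nu+1)\alpha^\nu+\nu\alpha^{\nu+1}\right), & 0<\nu\le\tau,\\ \frac12+\alpha C_\tau\left(1-\alpha^\tau-\tau\alpha^\nu(1-\alpha)\right), & \nu>\tau,\end{cases}$$ where $C_\tau=\frac{1}{2\alpha(1-\alpha^\tau)}$, and add $(i,v)$ to the summary.
   Formalization: The threshold τ is taken to be a positive integer; for non-integer τ the claim fails whenever M has a zero entry (e.g. m=1, M=0, α=τ=1/2: true inclusion probability 2/3, but p_τ ≈ 0.78). *)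

theory Defs
  imports "HOL-Probability.Probability" "HOL-Probability.Product_PMF"
begin

text \<open>
  A summary is represented by its set of (index, value) pairs, of type
  \<open>(nat \<times> int) set\<close>; a random summary is a PMF over such sets. The threshold
  \<open>\<tau>\<close> is a positive integer: the closed forms below are sums over the integers
  that are split at \<open>|x| = \<tau>\<close>. For a non-integer \<open>\<tau>\<close> they are not the
  probabilities of the corresponding events.
\<close>

definition geometric_noise :: "real \<Rightarrow> int pmf" where
  "geometric_noise \<alpha> = embed_pmf (\<lambda>x. (1 - \<alpha>) / (1 + \<alpha>) * \<alpha> powi \<bar>x\<bar>)"

definition threshold_sample ::
    "real \<Rightarrow> nat \<Rightarrow> (nat \<Rightarrow> nat) \<Rightarrow> nat set \<Rightarrow> (nat \<times> int) set pmf" where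
  "threshold_sample \<alpha> \<tau> M A =
    do {
      X \<leftarrow> Pi_pmf A 0 (\<lambda>_. geometric_noise \<alpha>);
      let M' = (\<lambda>i. int (M i) + X i);
      B \<leftarrow> Pi_pmf A False (\<lambda>i. bernoulli_pmf (min (real_of_int \<bar>M' i\<bar> / real \<tau>) 1));
      return_pmf {(i, M' i) | i. i \<in> A \<and> B i}
    }"

definition laborious_threshold ::
    "real \<Rightarrow> nat \<Rightarrow> nat \<Rightarrow> (nat \<Rightarrow> nat) \<Rightarrow> (nat \<times> int) set pmf" where
  "laborious_threshold \<alpha> \<tau> m M = threshold_sample \<alpha> \<tau> M {1..m}"

definition p_thr :: "real \<Rightarrow> nat \<Rightarrow> real" where
  "p_thr \<alpha> \<tau> = 2 * \<alpha> * (1 - \<alpha> ^ \<tau>) / (real \<tau> * (1 - \<alpha>\<^sup>2))"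

definition C_thr :: "real \<Rightarrow> nat \<Rightarrow> real" where
  "C_thr \<alpha> \<tau> = 1 / (2 * \<alpha> * (1 - \<alpha> ^ \<tau>))"

definition value_cdf :: "real \<Rightarrow> nat \<Rightarrow> int \<Rightarrow> real" where
  "value_cdf \<alpha> \<tau> \<nu> =
    (if \<nu> \<le> - int \<tau> then
       real \<tau> * \<alpha> powi (- \<nu>) * C_thr \<alpha> \<tau> * (1 - \<alpha>)
     else if \<nu> \<le> 0 then
       C_thr \<alpha> \<tau> * (- of_int \<nu> * \<alpha> powi (- \<nu>) + (of_int \<nu> + 1) * \<alpha> powi (- \<nu> + 1) - \<alpha> ^ (\<tau> + 1))
     else if \<nu> \<le> int \<tau> then
       1 / 2 + \<alpha> * C_thr \<alpha> \<tau> * (1 - (of_int \<nu> + 1) * \<alpha> powi \<nu> + of_int \<nu> * \<alpha> powi (\<nu> + 1))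
     else
       1 / 2 + \<alpha> * C_thr \<alpha> \<tau> * (1 - \<alpha> ^ \<tau> - real \<tau> * \<alpha> powi \<nu> * (1 - \<alpha>)))"

text \<open>A PMF on the integers is determined by its cumulative distribution function.\<close>

definition value_pmf :: "real \<Rightarrow> nat \<Rightarrow> int pmf" where
  "value_pmf \<alpha> \<tau> = (THE V. \<forall>\<nu>. measure_pmf.prob V {..\<nu>} = value_cdf \<alpha> \<tau> \<nu>)"

text \<open>
  The parameter \<open>n\<close> is meant to be the number of non-zero entries of \<open>M\<close> on
  \<open>{1..m}\<close>, so that \<open>m - n\<close> is the number of zero entries.
\<close>

definition threshold_algorithm ::
    "real \<Rightarrow> nat \<Rightarrow> nat \<Rightarrow> nat \<Rightarrow> (nat \<Rightarrow> nat) \<Rightarrow> (nat \<times> int) set pmf" where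
  "threshold_algorithm \<alpha> \<tau> m n M =
    do {
      S \<leftarrow> threshold_sample \<alpha> \<tau> M {i \<in> {1..m}. M i \<noteq> 0};
      k \<leftarrow> binomial_pmf (m - n) (p_thr \<alpha> \<tau>);
      L \<leftarrow> pmf_of_set {L. L \<subseteq> {i \<in> {1..m}. M i = 0} \<and> card L = k};
      v \<leftarrow> Pi_pmf L 0 (\<lambda>_. value_pmf \<alpha> \<tau>);
      return_pmf (S \<union> {(i, v i) | i. i \<in> L})
    }"

end

theory Submission imports Defs begin

text \<open>
  Under the laborious approach the entries are independent, and each one yields either nothing or
  a value. An entry with \<open>M i = 0\<close> yields the value \<open>v\<close> with probability
  \<open>(1 - \<alpha>) / (1 + \<alpha>) * \<alpha>^\<bar>v\<bar> * min (\<bar>v\<bar> / \<tau>) 1\<close>, which is \<open>p_thr \<alpha> \<tau>\<close> times the increment of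
  \<open>value_cdf \<alpha> \<tau>\<close> at \<open>v\<close>; so it is a coin of bias \<open>p_thr \<alpha> \<tau>\<close> followed by a draw from
  \<open>value_pmf \<alpha> \<tau>\<close>. The set of zero entries whose independent coins succeed has binomial size and
  is uniform given its size, which is how the short algorithm chooses it.
\<close>

section \<open>Integer distributions given by their cumulative distribution function\<close>

text \<open>The mass at \<open>v\<close> is the jump of the distribution function between
  \<open>v - 1\<close> and \<open>v\<close>. This gives the uniqueness required by the
  \<open>THE\<close> in \<open>value_pmf\<close>.\<close>

lemma pmf_int_eqI_cdf:
  fixes p q :: "int pmf"
  assumes "\<And>v. measure_pmf.prob p {..v} = measure_pmf.prob q {..v}"
  shows "p = q"
proof (rule pmf_eqI)
  fix v :: int
  have *: "pmf r v = measure_pmf.prob r {..v} - measure_pmf.prob r {..v - 1}" for r :: "int pmf"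
  proof -
    have "measure_pmf.prob r ({..v - 1} \<union> {v}) = measure_pmf.prob r {..v - 1} + measure_pmf.prob r {v}"
      by (rule measure_pmf.finite_measure_Union) auto
    moreover have "{..v - 1} \<union> {v} = {..v}" by auto
    ultimately have "measure_pmf.prob r {..v} = measure_pmf.prob r {..v - 1} + measure_pmf.prob r {v}"
      by (simp only:)
    then show ?thesis by (simp add: measure_pmf_single)
  qed
  show "pmf p v = pmf q v" by (simp add: *[of p] *[of q] assms)
qed

text \<open>A candidate density \<open>f\<close> telescopes against a closed form \<open>F\<close>,
  so its total mass and its distribution function follow from two limits. \<open>lim_bot\<close> is
  assumed from every start \<open>v\<close> because the left tail is summed up to an arbitrary
  point.\<close>

locale int_cdf =
  fixes f F :: "int \<Rightarrow> real"
  assumes nonneg: "0 \<le> f v"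
    and diff: "f v = F v - F (v - 1)"
    and lim_bot: "(\<lambda>n. F (v - int n)) \<longlonglongrightarrow> 0"
    and lim_top: "(\<lambda>n. F (int n)) \<longlonglongrightarrow> 1"
begin

lemma nn_integral_atMost: "(\<integral>\<^sup>+v. ennreal (f v) \<partial>count_space {..w}) = ennreal (F w)"
proof -
  have "bij_betw (\<lambda>n. w - int n) UNIV {..w}"
    by (rule bij_betwI[where g = "\<lambda>v. nat (w - v)"]) auto
  then have "(\<integral>\<^sup>+v. ennreal (f v) \<partial>count_space {..w}) = (\<integral>\<^sup>+n. ennreal (f (w - int n)) \<partial>count_space UNIV)"
    by (rule nn_integral_bij_count_space[symmetric])
  also have "\<dots> = (\<Sum>n. ennreal (f (w - int n)))"
    by (rule nn_integral_count_space_nat)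
  also have "\<dots> = ennreal (F w)"
  proof (rule suminf_ennreal_eq)
    show "(\<lambda>n. f (w - int n)) sums F w"
      using telescope_sums'[OF lim_bot[of w]] by (simp add: diff algebra_simps)
  qed (rule nonneg)
  finally show ?thesis .
qed

lemma nn_integral_pos: "(\<integral>\<^sup>+v. ennreal (f v) \<partial>count_space {0<..}) = ennreal (1 - F 0)"
proof -
  have "bij_betw (\<lambda>n. int (Suc n)) UNIV {0<..}"
    by (rule bij_betwI[where g = "\<lambda>v. nat (v - 1)"]) auto
  then have "(\<integral>\<^sup>+v. ennreal (f v) \<partial>count_space {0<..}) = (\<integral>\<^sup>+n. ennreal (f (int (Suc n))) \<partial>count_space UNIV)"
    by (rule nn_integral_bij_count_space[symmetric])
  also have "\<dots> = (\<Sum>n. ennreal (f (int (Suc n))))"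
    by (rule nn_integral_count_space_nat)
  also have "\<dots> = ennreal (1 - F 0)"
  proof (rule suminf_ennreal_eq)
    show "(\<lambda>n. f (int (Suc n))) sums (1 - F 0)"
      using telescope_sums[OF lim_top] by (simp add: diff)
  qed (rule nonneg)
  finally show ?thesis .
qed

text \<open>\<open>F\<close> is nondecreasing, so it lies between its limits. Since
  \<open>ennreal\<close> sends negative reals to 0, these bounds are what allow
  \<open>ennreal (F 0)\<close> and \<open>ennreal (1 - F 0)\<close> to add up to 1.\<close>

lemma cdf_nonneg: "0 \<le> F v" and cdf_zero_le_1: "F 0 \<le> 1"
proof -
  have mono: "F v \<le> F (v + int n)" for v n
  proof (induction n)
    case (Suc n)
    then show ?case using nonneg[of "v + int (Suc n)"] diff[of "v + int (Suc n)"]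
      by (simp add: algebra_simps)
  qed simp
  show "0 \<le> F v"
  proof (rule LIMSEQ_le_const2[OF lim_bot[of v]], intro exI allI impI)
    show "F (v - int n) \<le> F v" for n using mono[of "v - int n" n] by simp
  qed
  show "F 0 \<le> 1"
  proof (rule LIMSEQ_le_const[OF lim_top], intro exI allI impI)
    show "F 0 \<le> F (int n)" for n using mono[of 0 n] by simp
  qed
qed

lemma nn_integral_UNIV: "(\<integral>\<^sup>+v. ennreal (f v) \<partial>count_space UNIV) = 1"
proof -
  have "(UNIV :: int set) = {..0} \<union> {0<..}" by auto
  then have "(\<integral>\<^sup>+v. ennreal (f v) \<partial>count_space UNIV) =
      (\<integral>\<^sup>+v. ennreal (f v) * indicator ({..0} \<union> {0<..}) v \<partial>count_space UNIV)"
    by simp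
  also have "\<dots> = (\<integral>\<^sup>+v. ennreal (f v) * indicator {..0} v \<partial>count_space UNIV) +
      (\<integral>\<^sup>+v. ennreal (f v) * indicator {0<..} v \<partial>count_space UNIV)"
    by (rule nn_integral_disjoint_pair_countspace) auto
  also have "\<dots> = ennreal (F 0) + ennreal (1 - F 0)"
    by (simp add: nn_integral_atMost nn_integral_pos flip: nn_integral_count_space_indicator)
  also have "\<dots> = 1"
    using cdf_nonneg[of 0] cdf_zero_le_1 by (simp flip: ennreal_plus)
  finally show ?thesis .
qed

lemma pmf_embed: "pmf (embed_pmf f) v = f v"
  by (rule pmf_embed_pmf) (simp_all add: nonneg nn_integral_UNIV)

lemma prob_embed_atMost: "measure_pmf.prob (embed_pmf f) {..v} = F v"
proof -
  have "emeasure (measure_pmf (embed_pmf f)) {..v} = ennreal (F v)"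
    by (simp add: nn_integral_pmf[symmetric] pmf_embed nn_integral_atMost)
  then show ?thesis by (simp add: measure_def cdf_nonneg)
qed

end

section \<open>Products of probability mass functions\<close>

text \<open>The conditional restores the default \<open>d'\<close> outside \<open>A\<close>, where
  \<open>h i d\<close> may differ from it.\<close>

lemma Pi_pmf_map_indexed:
  assumes "finite A"
  shows "Pi_pmf A d' (\<lambda>i. map_pmf (h i) (p i)) =
    map_pmf (\<lambda>g i. if i \<in> A then h i (g i) else d') (Pi_pmf A d p)"
  using assms by (simp add: map_pmf_def Pi_pmf_bind[where d' = d])

text \<open>With \<open>None\<close> for an index absent from the summary, \<open>Map.graph\<close>
  turns a partial map into a summary, and independent choices on disjoint index sets become a
  union.\<close>

lemma graph_Pi_pmf_union:
  assumes "finite A" "finite B" "A \<inter> B = {}"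
  shows "map_pmf Map.graph (Pi_pmf (A \<union> B) None p) =
    do {
      S \<leftarrow> map_pmf Map.graph (Pi_pmf A None p);
      T \<leftarrow> map_pmf Map.graph (Pi_pmf B None p);
      return_pmf (S \<union> T)
    }"
proof -
  have "Map.graph (\<lambda>x. if x \<in> A then f x else g x) = Map.graph f \<union> Map.graph g"
    \<comment> \<open>The identity needs each function to be \<open>None\<close> off its own block,
      which holds on the supports.\<close>
    if "f \<in> set_pmf (Pi_pmf A None p)" "g \<in> set_pmf (Pi_pmf B None p)" for f g
  proof -
    have "\<forall>x. x \<notin> A \<longrightarrow> f x = None"
      using subsetD[OF set_Pi_pmf_subset[OF assms(1)] that(1)] by (rule CollectD)
    moreover have "\<forall>x. x \<notin> B \<longrightarrow> g x = None"
      using subsetD[OF set_Pi_pmf_subset[OF assms(2)] that(2)] by (rule CollectD)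
    then have "\<forall>x\<in>A. g x = None"
      using assms(3) by blast
    ultimately show ?thesis
      unfolding Map.graph_def by (intro set_eqI) (auto split: if_splits)
  qed
  then show ?thesis
    unfolding Pi_pmf_union[OF assms] pair_pmf_def map_bind_pmf bind_map_pmf
    by (intro bind_pmf_cong refl) simp
qed

text \<open>Both sides give \<open>L \<subseteq> A\<close> the mass
  \<open>p ^ card L * (1 - p) ^ (card A - card L)\<close>: on the right the binomial coefficient
  cancels against the number of subsets of that size.\<close>

lemma random_subset_eq_binomial_uniform:
  assumes "finite A" "0 \<le> p" "p \<le> 1"
  shows "map_pmf (\<lambda>b. {i \<in> A. b i}) (Pi_pmf A False (\<lambda>_. bernoulli_pmf p)) =
    do {
      k \<leftarrow> binomial_pmf (card A) p;
      pmf_of_set {L. L \<subseteq> A \<and> card L = k}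
    }" (is "?lhs = ?rhs")
proof (rule pmf_eqI)
  fix L
  show "pmf ?lhs L = pmf ?rhs L"
  proof (cases "L \<subseteq> A")
    case True
    then have fin: "finite L" and le: "card L \<le> card A"
      using assms(1) by (auto intro: finite_subset card_mono)
    have "pmf ?lhs L = measure_pmf.prob (Pi_pmf A False (\<lambda>_. bernoulli_pmf p)) {\<lambda>i. i \<in> L}"
      unfolding pmf_map
    proof (rule measure_pmf.finite_measure_eq_AE)
      \<comment> \<open>Many predicates cut out \<open>L\<close> within \<open>A\<close>; on the
        support they are \<open>False\<close> outside \<open>A\<close>, which leaves only membership
        in \<open>L\<close>.\<close>
      show "AE b in Pi_pmf A False (\<lambda>_. bernoulli_pmf p).
          (b \<in> (\<lambda>b. {i \<in> A. b i}) -` {L}) = (b \<in> {\<lambda>i. i \<in> L})"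
        using set_Pi_pmf_subset[OF assms(1), of False "\<lambda>_. bernoulli_pmf p"] True
        by (auto simp: AE_measure_pmf_iff fun_eq_iff)
    qed auto
    also have "\<dots> = (\<Prod>i\<in>A. if i \<in> L then p else 1 - p)"
      using assms True
      by (simp add: measure_pmf_single, subst pmf_Pi')
        (auto intro!: prod.cong)
    also have "\<dots> = p ^ card L * (1 - p) ^ (card A - card L)"
      using assms(1) True fin
      by (simp add: prod.If_cases Int_absorb1 Diff_eq[symmetric] card_Diff_subset)
    finally have lhs: "pmf ?lhs L = p ^ card L * (1 - p) ^ (card A - card L)" .
    have "pmf ?rhs L = (\<Sum>k\<in>{card L}. pmf (pmf_of_set {L. L \<subseteq> A \<and> card L = k}) L
        * pmf (binomial_pmf (card A) p) k)"
      unfolding pmf_bind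
    proof (rule integral_measure_pmf_real)
      fix k assume "k \<in> set_pmf (binomial_pmf (card A) p)"
        and nz: "pmf (pmf_of_set {L. L \<subseteq> A \<and> card L = k}) L \<noteq> 0"
      \<comment> \<open>Subsets of size \<open>k\<close> then exist, so \<open>pmf_of_set\<close> is
        applied to a nonempty set.\<close>
      then have "k \<le> card A"
        using assms by (auto simp: set_pmf_binomial_eq split: if_splits)
      then obtain L' where "L' \<subseteq> A" "card L' = k"
        using obtain_subset_with_card_n by metis
      with nz assms(1) show "k \<in> {card L}"
        by (subst (asm) pmf_of_set) (auto simp: indicator_def split: if_splits)
    qed auto
    also have "\<dots> = p ^ card L * (1 - p) ^ (card A - card L)"
      using assms True le
      by (subst sum.insert, simp, simp, subst pmf_of_set)
        (auto simp: n_subsets[OF assms(1)])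
    finally show ?thesis using lhs by simp
  next
    case False
    then have "L \<notin> set_pmf ?lhs" by auto
    moreover have "L \<notin> set_pmf ?rhs"
    proof
      assume "L \<in> set_pmf ?rhs"
      then obtain k where k: "k \<in> set_pmf (binomial_pmf (card A) p)"
        and L: "L \<in> set_pmf (pmf_of_set {L. L \<subseteq> A \<and> card L = k})"
        by auto
      from k have "k \<le> card A"
        using assms by (auto simp: set_pmf_binomial_eq split: if_splits)
      then obtain L' where "L' \<subseteq> A" "card L' = k"
        using obtain_subset_with_card_n by metis
      with L assms(1) False show False
        by (subst (asm) set_pmf_of_set) auto
    qed
    ultimately have "pmf ?lhs L = 0" "pmf ?rhs L = 0"
      unfolding pmf_eq_0_set_pmf by simp_all
    then show ?thesis by simp
  qed
qed

text \<open>All coins can be tossed before any value is drawn. Given the coins, each failed index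
  carries the point mass at the default \<open>None\<close>, so the product shrinks to the set of
  successes.\<close>

lemma graph_Pi_pmf_bernoulli_mixture:
  fixes A :: "'a set" and V :: "'b pmf" and d :: 'b
  assumes "finite A" "0 \<le> p" "p \<le> 1"
  shows "map_pmf Map.graph (Pi_pmf A None
      (\<lambda>_. bernoulli_pmf p \<bind> (\<lambda>b. if b then map_pmf Some V else return_pmf None))) =
    do {
      k \<leftarrow> binomial_pmf (card A) p;
      L \<leftarrow> pmf_of_set {L. L \<subseteq> A \<and> card L = k};
      v \<leftarrow> Pi_pmf L d (\<lambda>_. V);
      return_pmf {(i, v i) | i. i \<in> L}
    }"
proof -
  have *: "map_pmf Map.graph (Pi_pmf L None (\<lambda>_. map_pmf Some V)) =
      Pi_pmf L d (\<lambda>_. V) \<bind> (\<lambda>v. return_pmf {(i, v i) | i. i \<in> L})" if "finite L" for L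
    using that
    by (auto simp: Pi_pmf_map_indexed[where d = d] pmf.map_comp o_def map_pmf_def[symmetric]
        Map.graph_def intro!: map_pmf_cong split: if_splits)
  have "map_pmf Map.graph (Pi_pmf A None
      (\<lambda>_. bernoulli_pmf p \<bind> (\<lambda>b. if b then map_pmf Some V else return_pmf None))) =
    do {
      L \<leftarrow> map_pmf (\<lambda>b. {i \<in> A. b i}) (Pi_pmf A False (\<lambda>_. bernoulli_pmf p));
      v \<leftarrow> Pi_pmf L d (\<lambda>_. V);
      return_pmf {(i, v i) | i. i \<in> L}
    }"
    by (subst Pi_pmf_bind[OF assms(1), where d' = False])
      (simp add: map_bind_pmf bind_map_pmf Pi_pmf_if_set[OF assms(1)] * assms(1))
  then show ?thesis
    by (simp only: random_subset_eq_binomial_uniform[OF assms] bind_assoc_pmf)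
qed

text \<open>The mass at \<open>None\<close> is what the masses at \<open>Some v\<close> leave over.
  This avoids computing the probability that an entry is rejected.\<close>

lemma pmf_option_eqI:
  assumes "\<And>v. pmf p (Some v) = pmf q (Some v)"
  shows "p = q"
proof (rule pmf_eqI)
  have *: "pmf r None = 1 - measure_pmf.prob r (range Some)" for r :: "'a option pmf"
  proof -
    have "{None} = - range (Some :: 'a \<Rightarrow> _)" using notin_range_Some by auto
    then show ?thesis
      by (simp add: measure_pmf_single[symmetric] measure_pmf.prob_compl[symmetric] Compl_eq_Diff_UNIV)
  qed
  have "emeasure p (range Some) = emeasure q (range Some)"
    by (simp add: assms nn_integral_pmf'[symmetric])
  then have "measure_pmf.prob p (range Some) = measure_pmf.prob q (range Some)"
    by (simp add: measure_def)
  then show "pmf p v = pmf q v" for v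
    by (cases v) (simp_all add: assms *)
qed

section \<open>Geometric noise and the value distribution\<close>

lemma pmf_geometric_noise:
  assumes "0 < \<alpha>" "\<alpha> < 1"
  shows "pmf (geometric_noise \<alpha>) x = (1 - \<alpha>) / (1 + \<alpha>) * \<alpha> powi \<bar>x\<bar>"
proof -
  let ?f = "\<lambda>x. (1 - \<alpha>) / (1 + \<alpha>) * \<alpha> powi \<bar>x\<bar>"
  \<comment> \<open>The lower geometric tail for \<open>x \<le> 0\<close>, and one minus the upper
    tail beyond \<open>x\<close> otherwise.\<close>
  let ?F = "\<lambda>x. if x \<le> 0 then \<alpha> powi (- x) / (1 + \<alpha>) else 1 - \<alpha> powi (x + 1) / (1 + \<alpha>)"
  interpret int_cdf ?f ?F
  proof
    show "?f v = ?F v - ?F (v - 1)" for v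
    proof -
      have "\<alpha> powi (1 - v) = \<alpha> * \<alpha> powi (- v)" "\<alpha> powi (v + 1) = \<alpha> * \<alpha> powi v"
        using assms power_int_add[of \<alpha> 1 "- v"] power_int_add[of \<alpha> v 1] by auto
      moreover have "1 - \<alpha> * \<alpha> / (1 + \<alpha>) - 1 / (1 + \<alpha>) = (1 - \<alpha>) / (1 + \<alpha>) * \<alpha>"
        using assms by (simp add: divide_simps) (simp add: algebra_simps)
      ultimately show ?thesis
        using assms
        \<comment> \<open>Only at \<open>v = 1\<close> do \<open>v\<close> and \<open>v - 1\<close>
          fall into different branches of \<open>?F\<close>.\<close>
        by (cases "v = 1")
          (auto simp: power2_eq_square left_diff_distrib diff_divide_distrib)
    qed
    show "(\<lambda>n. ?F (v - int n)) \<longlonglongrightarrow> 0" for v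
    proof (rule Lim_transform_eventually)
      show "(\<lambda>n. \<alpha> powi (- v) * \<alpha> ^ n / (1 + \<alpha>)) \<longlonglongrightarrow> 0"
        using assms by (auto intro!: tendsto_eq_intros LIMSEQ_power_zero)
      show "\<forall>\<^sub>F n in sequentially. \<alpha> powi (- v) * \<alpha> ^ n / (1 + \<alpha>) = ?F (v - int n)"
        using eventually_ge_at_top[of "nat v"]
      proof eventually_elim
        case (elim n)
        then show ?case
          using assms power_int_add[of \<alpha> "- v" "int n"] by (simp add: algebra_simps)
      qed
    qed
    show "(\<lambda>n. ?F (int n)) \<longlonglongrightarrow> 1"
    proof (rule Lim_transform_eventually)
      show "(\<lambda>n. 1 - \<alpha> * \<alpha> ^ n / (1 + \<alpha>)) \<longlonglongrightarrow> 1"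
        using assms by (auto intro!: tendsto_eq_intros LIMSEQ_power_zero)
      show "\<forall>\<^sub>F n in sequentially. 1 - \<alpha> * \<alpha> ^ n / (1 + \<alpha>) = ?F (int n)"
        using eventually_gt_at_top[of 0]
      proof eventually_elim
        case (elim n)
        then show ?case
          using assms power_int_add[of \<alpha> "int n" 1] by simp
      qed
    qed
  qed (use assms in simp)
  show ?thesis unfolding geometric_noise_def by (rule pmf_embed)
qed

text \<open>The law of the noise on a zero entry conditioned on being sampled: geometric mass times
  inclusion probability, divided by \<open>p_thr \<alpha> \<tau>\<close>.\<close>

definition value_density :: "real \<Rightarrow> nat \<Rightarrow> int \<Rightarrow> real" where
  "value_density \<alpha> \<tau> v = C_thr \<alpha> \<tau> * (1 - \<alpha>)\<^sup>2 * min (of_int \<bar>v\<bar>) (real \<tau>) * \<alpha> powi \<bar>v\<bar>"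

lemma C_thr_pos:
  assumes "0 < \<alpha>" "\<alpha> < 1" "\<tau> > 0"
  shows "C_thr \<alpha> \<tau> > 0"
  using assms power_Suc_less_one[of \<alpha> "\<tau> - 1"] by (simp add: C_thr_def)

text \<open>The left side is \<open>value_cdf \<alpha> \<tau> 0\<close>: the density is even and
  vanishes at 0, so each half-line carries mass 1/2.\<close>

lemma C_thr_normalization:
  assumes "0 < \<alpha>" "\<alpha> < 1" "\<tau> > 0"
  shows "\<alpha> * C_thr \<alpha> \<tau> * (1 - \<alpha> ^ \<tau>) = 1 / 2"
  using assms power_Suc_less_one[of \<alpha> "\<tau> - 1"] by (simp add: C_thr_def field_simps)

text \<open>This and the next three lemmas express \<open>value_cdf\<close> in a natural number
  \<open>k\<close>, on ranges that overlap at \<open>- \<tau>\<close>, 0 and \<open>\<tau>\<close>.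
  Any two consecutive integers are then covered by one formula.\<close>

lemma value_cdf_neg_far:
  assumes "0 < \<alpha>" "\<alpha> < 1" "\<tau> > 0" "\<tau> \<le> k"
  shows "value_cdf \<alpha> \<tau> (- int k) = C_thr \<alpha> \<tau> * real \<tau> * \<alpha> ^ k * (1 - \<alpha>)"
  using assms by (simp add: value_cdf_def)

lemma value_cdf_neg_near:
  assumes "0 < \<alpha>" "\<alpha> < 1" "\<tau> > 0" "k \<le> \<tau>"
  shows "value_cdf \<alpha> \<tau> (- int k) =
    C_thr \<alpha> \<tau> * (real k * \<alpha> ^ k - (real k - 1) * (\<alpha> * \<alpha> ^ k) - \<alpha> * \<alpha> ^ \<tau>)"
proof (cases "k = \<tau>")
  case True
  then show ?thesis
    using value_cdf_neg_far[OF assms(1-3), of k] by (simp add: algebra_simps)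
next
  case False
  then show ?thesis
    using assms power_int_add_1[of \<alpha> "int k"] by (simp add: value_cdf_def algebra_simps)
qed

lemma value_cdf_pos_near:
  assumes "0 < \<alpha>" "\<alpha> < 1" "\<tau> > 0" "k \<le> \<tau>"
  shows "value_cdf \<alpha> \<tau> (int k) =
    1 / 2 + \<alpha> * C_thr \<alpha> \<tau> * (1 - (real k + 1) * \<alpha> ^ k + real k * (\<alpha> * \<alpha> ^ k))"
proof (cases "k = 0")
  case True
  then show ?thesis
    using value_cdf_neg_near[OF assms(1-3), of 0] C_thr_normalization[OF assms(1-3)]
    by (simp add: algebra_simps)
next
  case False
  then show ?thesis
    using assms power_int_add_1[of \<alpha> "int k"] by (simp add: value_cdf_def)
qed

text \<open>The constants of the last branch add up to 1 by \<open>C_thr_normalization\<close>,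
  which exposes the upper tail and the limit.\<close>

lemma value_cdf_pos_far:
  assumes "0 < \<alpha>" "\<alpha> < 1" "\<tau> > 0" "\<tau> \<le> k"
  shows "value_cdf \<alpha> \<tau> (int k) = 1 - \<alpha> * C_thr \<alpha> \<tau> * real \<tau> * \<alpha> ^ k * (1 - \<alpha>)"
proof (cases "k = \<tau>")
  case True
  then show ?thesis
    using value_cdf_pos_near[OF assms(1-3), of k] C_thr_normalization[OF assms(1-3)]
    by (simp add: algebra_simps)
next
  case False
  then show ?thesis
    using assms C_thr_normalization[OF assms(1-3)]
    by (simp add: value_cdf_def algebra_simps)
qed

lemma value_cdf_diff:
  assumes "0 < \<alpha>" "\<alpha> < 1" "\<tau> > 0"
  shows "value_density \<alpha> \<tau> v = value_cdf \<alpha> \<tau> v - value_cdf \<alpha> \<tau> (v - 1)"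
proof -
  note near = value_cdf_neg_near[OF assms] value_cdf_pos_near[OF assms]
    and far = value_cdf_neg_far[OF assms] value_cdf_pos_far[OF assms]
  \<comment> \<open>Writing a positive \<open>v\<close> as \<open>Suc k\<close> makes its
    predecessor \<open>int k\<close>; for \<open>v = 1\<close> this is 0, which
    \<open>value_cdf_pos_near\<close> includes.\<close>
  consider k where "v = - int k" "\<tau> \<le> k" | k where "v = - int k" "k < \<tau>"
    | k where "v = int (Suc k)" "k < \<tau>" | k where "v = int (Suc k)" "\<tau> \<le> k"
  proof (cases "v \<le> 0")
    case True
    then have "v = - int (nat (- v))" by simp
    then show ?thesis using that(1,2) by (cases "\<tau> \<le> nat (- v)") (auto simp del: int_nat_eq)
  next
    case False
    then have "v = int (Suc (nat (v - 1)))" by simp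
    then show ?thesis using that(3,4) by (cases "\<tau> \<le> nat (v - 1)") (auto simp del: int_nat_eq)
  qed
  then show ?thesis
  proof cases
    case (1 k)
    have pred: "v - 1 = - int (Suc k)" using 1 by simp
    show ?thesis unfolding pred unfolding 1 using 1(2)
      by (subst (1 2) far, simp_all add: value_density_def min_absorb2)
        (simp add: algebra_simps power2_eq_square)
  next
    case (2 k)
    have pred: "v - 1 = - int (Suc k)" using 2 by simp
    show ?thesis unfolding pred unfolding 2 using 2(2)
      by (subst (1 2) near, simp_all add: value_density_def min_absorb1)
        (simp add: algebra_simps power2_eq_square)
  next
    case (3 k)
    have pred: "v - 1 = int k" using 3 by simp
    show ?thesis unfolding pred unfolding 3 using 3(2)
      by (subst (1 2) near, simp_all add: value_density_def min_absorb1 power_int_add_1 del: of_nat_Suc)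
        (simp add: algebra_simps power2_eq_square)
  next
    case (4 k)
    have pred: "v - 1 = int k" using 4 by simp
    show ?thesis unfolding pred unfolding 4 using 4(2)
      by (subst (1 2) far, simp_all add: value_density_def min_absorb2 del: of_nat_Suc)
        (simp add: algebra_simps power2_eq_square)
  qed
qed

lemma value_cdf_int_cdf:
  assumes "0 < \<alpha>" "\<alpha> < 1" "\<tau> > 0"
  shows "int_cdf (value_density \<alpha> \<tau>) (value_cdf \<alpha> \<tau>)"
proof
  show "0 \<le> value_density \<alpha> \<tau> v" for v
    using assms C_thr_pos[OF assms] by (simp add: value_density_def)
  show "value_density \<alpha> \<tau> v = value_cdf \<alpha> \<tau> v - value_cdf \<alpha> \<tau> (v - 1)" for v
    by (rule value_cdf_diff[OF assms])
  show "(\<lambda>n. value_cdf \<alpha> \<tau> (v - int n)) \<longlonglongrightarrow> 0" for v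
  proof (rule Lim_transform_eventually)
    show "(\<lambda>n. real \<tau> * (\<alpha> powi (- v) * \<alpha> ^ n) * C_thr \<alpha> \<tau> * (1 - \<alpha>)) \<longlonglongrightarrow> 0"
      using assms by (auto intro!: tendsto_eq_intros LIMSEQ_power_zero)
    show "\<forall>\<^sub>F n in sequentially.
        real \<tau> * (\<alpha> powi (- v) * \<alpha> ^ n) * C_thr \<alpha> \<tau> * (1 - \<alpha>) = value_cdf \<alpha> \<tau> (v - int n)"
      \<comment> \<open>From this \<open>n\<close> on, \<open>v - int n \<le> - int \<tau>\<close>,
        so the first branch of \<open>value_cdf\<close> applies.\<close>
      using eventually_ge_at_top[of "nat (v + int \<tau>)"]
    proof eventually_elim
      case (elim n)
      then have "v - int n \<le> - int \<tau>" by linarith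
      moreover have "\<alpha> powi (- (v - int n)) = \<alpha> powi (- v) * \<alpha> ^ n"
        using assms power_int_add[of \<alpha> "- v" "int n"] by simp
      ultimately show ?case by (simp add: value_cdf_def)
    qed
  qed
  show "(\<lambda>n. value_cdf \<alpha> \<tau> (int n)) \<longlonglongrightarrow> 1"
  proof (rule Lim_transform_eventually)
    show "(\<lambda>n. 1 - \<alpha> * C_thr \<alpha> \<tau> * real \<tau> * \<alpha> ^ n * (1 - \<alpha>)) \<longlonglongrightarrow> 1"
      using assms by (auto intro!: tendsto_eq_intros LIMSEQ_power_zero)
    show "\<forall>\<^sub>F n in sequentially.
        1 - \<alpha> * C_thr \<alpha> \<tau> * real \<tau> * \<alpha> ^ n * (1 - \<alpha>) = value_cdf \<alpha> \<tau> (int n)"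
      using eventually_ge_at_top[of \<tau>]
      by eventually_elim (simp add: value_cdf_pos_far[OF assms])
  qed
qed

text \<open>The embedded density witnesses existence for the \<open>THE\<close>, and
  \<open>pmf_int_eqI_cdf\<close> gives uniqueness.\<close>

lemma pmf_value_pmf:
  assumes "0 < \<alpha>" "\<alpha> < 1" "\<tau> > 0"
  shows "pmf (value_pmf \<alpha> \<tau>) v = value_density \<alpha> \<tau> v"
proof -
  interpret int_cdf "value_density \<alpha> \<tau>" "value_cdf \<alpha> \<tau>"
    by (rule value_cdf_int_cdf[OF assms])
  have "value_pmf \<alpha> \<tau> = embed_pmf (value_density \<alpha> \<tau>)"
    unfolding value_pmf_def
    by (rule the_equality) (auto simp: prob_embed_atMost intro: pmf_int_eqI_cdf)
  then show ?thesis by (simp add: pmf_embed)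
qed

section \<open>Threshold sampling of a single entry\<close>

definition threshold_entry :: "real \<Rightarrow> nat \<Rightarrow> int \<Rightarrow> int option pmf" where
  "threshold_entry \<alpha> \<tau> c =
    do {
      x \<leftarrow> geometric_noise \<alpha>;
      map_pmf (\<lambda>b. if b then Some (c + x) else None)
        (bernoulli_pmf (min (real_of_int \<bar>c + x\<bar> / real \<tau>) 1))
    }"

text \<open>Drawing all noise and then all coins is fused coordinatewise by
  \<open>Pi_pmf_bind\<close>, which makes the independence of the entries explicit.\<close>

lemma threshold_sample_eq_graph:
  assumes "finite A"
  shows "threshold_sample \<alpha> \<tau> M A =
    map_pmf Map.graph (Pi_pmf A None (\<lambda>i. threshold_entry \<alpha> \<tau> (int (M i))))"
  using assms unfolding threshold_sample_def threshold_entry_def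
  by (auto simp: Pi_pmf_bind[where d' = 0] Pi_pmf_map_indexed[where d = False] map_bind_pmf
      pmf.map_comp o_def Let_def Map.graph_def map_pmf_def[symmetric]
      intro!: bind_pmf_cong map_pmf_cong split: if_splits)

lemma pmf_threshold_entry_zero:
  assumes "0 < \<alpha>" "\<alpha> < 1"
  shows "pmf (threshold_entry \<alpha> \<tau> 0) (Some v) =
    (1 - \<alpha>) / (1 + \<alpha>) * \<alpha> powi \<bar>v\<bar> * min (real_of_int \<bar>v\<bar> / real \<tau>) 1"
proof -
  let ?q = "\<lambda>x. min (real_of_int \<bar>x\<bar> / real \<tau>) 1"
  have *: "pmf (map_pmf (\<lambda>b. if b then Some x else None) (bernoulli_pmf (?q x))) (Some v) =
      (if x = v then ?q v else 0)" for x
  proof -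
    have "(\<lambda>b. if b then Some x else None) -` {Some v} = (if x = v then {True} else {})"
      by (auto split: if_splits)
    then show ?thesis by (auto simp: pmf_map measure_pmf_single)
  qed
  \<comment> \<open>With true count 0, only the noise value \<open>x = v\<close> can produce
    \<open>Some v\<close>.\<close>
  have "pmf (threshold_entry \<alpha> \<tau> 0) (Some v) =
      (\<Sum>x\<in>{v}. (if x = v then ?q v else 0) * pmf (geometric_noise \<alpha>) x)"
    unfolding threshold_entry_def pmf_bind add_0 *
    by (rule integral_measure_pmf_real) (auto split: if_splits)
  then show ?thesis by (simp add: pmf_geometric_noise[OF assms])
qed

text \<open>These make \<open>p_thr\<close> a legitimate coin bias. The upper bound multiplies
  \<open>2 * \<alpha> \<le> 1 + \<alpha>\<close> by Bernoulli's inequality for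
  \<open>\<alpha> ^ \<tau>\<close>.\<close>

lemma p_thr_bounds:
  assumes "0 < \<alpha>" "\<alpha> < 1" "\<tau> > 0"
  shows "0 \<le> p_thr \<alpha> \<tau>" "p_thr \<alpha> \<tau> \<le> 1"
proof -
  have sq: "\<alpha>\<^sup>2 < 1" "\<alpha> ^ \<tau> \<le> 1"
    using assms by (auto simp: power_less_one_iff power_le_one)
  then show "0 \<le> p_thr \<alpha> \<tau>"
    using assms by (simp add: p_thr_def)
  have "1 - \<alpha> ^ \<tau> \<le> real \<tau> * (1 - \<alpha>)"
    using Bernoulli_inequality[of "\<alpha> - 1" \<tau>] assms by (simp add: algebra_simps)
  then have "2 * \<alpha> * (1 - \<alpha> ^ \<tau>) \<le> (1 + \<alpha>) * (real \<tau> * (1 - \<alpha>))"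
    using assms sq by (intro mult_mono) auto
  also have "\<dots> = real \<tau> * (1 - \<alpha>\<^sup>2)"
    by (simp add: algebra_simps power2_eq_square)
  finally show "p_thr \<alpha> \<tau> \<le> 1"
    using assms sq by (simp add: p_thr_def)
qed

text \<open>The product of \<open>p_thr\<close> and \<open>C_thr\<close> is
  \<open>1 / (real \<tau> * (1 - \<alpha>\<^sup>2))\<close>; with the factor
  \<open>(1 - \<alpha>)\<^sup>2\<close> of the density this leaves the geometric constant over
  \<open>\<tau>\<close>.\<close>

lemma threshold_entry_zero:
  assumes "0 < \<alpha>" "\<alpha> < 1" "\<tau> > 0"
  shows "threshold_entry \<alpha> \<tau> 0 = bernoulli_pmf (p_thr \<alpha> \<tau>) \<bind>
    (\<lambda>b. if b then map_pmf Some (value_pmf \<alpha> \<tau>) else return_pmf None)"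
proof (rule pmf_option_eqI)
  fix v
  have nz: "1 - \<alpha> ^ \<tau> \<noteq> 0" "1 + \<alpha> \<noteq> 0" "1 - \<alpha> \<noteq> 0" "\<alpha> \<noteq> 0" "real \<tau> \<noteq> 0"
    using assms power_Suc_less_one[of \<alpha> "\<tau> - 1"] by auto
  have sq: "1 - \<alpha>\<^sup>2 = (1 - \<alpha>) * (1 + \<alpha>)" by (simp add: algebra_simps power2_eq_square)
  have min: "min (real_of_int \<bar>v\<bar>) (real \<tau>) = real \<tau> * min (real_of_int \<bar>v\<bar> / real \<tau>) 1"
    using assms by (auto simp: min_def field_simps)
  have "p_thr \<alpha> \<tau> * value_density \<alpha> \<tau> v =
      (1 - \<alpha>) / (1 + \<alpha>) * \<alpha> powi \<bar>v\<bar> * min (real_of_int \<bar>v\<bar> / real \<tau>) 1"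
    unfolding p_thr_def value_density_def C_thr_def min sq using nz
    by (simp add: divide_simps power2_eq_square)
  then show "pmf (threshold_entry \<alpha> \<tau> 0) (Some v) = pmf (bernoulli_pmf (p_thr \<alpha> \<tau>) \<bind>
      (\<lambda>b. if b then map_pmf Some (value_pmf \<alpha> \<tau>) else return_pmf None)) (Some v)"
    using p_thr_bounds[OF assms]
    by (simp add: pmf_threshold_entry_zero[OF assms(1,2)] pmf_bind pmf_map_inj' pmf_value_pmf[OF assms]
        mult.commute)
qed

theorem theorem2:
  fixes M :: "nat \<Rightarrow> nat" and m n \<tau> :: nat and \<alpha> :: real
  assumes "card {i \<in> {1..m}. M i \<noteq> 0} = n"
    and "0 < \<alpha>" and "\<alpha> < 1"
    and "\<tau> > 0"
  shows "threshold_algorithm \<alpha> \<tau> m n M = laborious_threshold \<alpha> \<tau> m M"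
proof -
  let ?A = "{i \<in> {1..m}. M i \<noteq> 0}" and ?Z = "{i \<in> {1..m}. M i = 0}"
  let ?p = "\<lambda>i. threshold_entry \<alpha> \<tau> (int (M i))"
  have split: "{1..m} = ?A \<union> ?Z" by auto
  have "card {1..m} = card ?A + card ?Z"
    by (subst split, rule card_Un_disjoint) auto
  then have card: "card ?Z = m - n" using assms(1) by simp
  \<comment> \<open>On \<open>?Z\<close> every count is 0, so all factors are the same
    coin-and-value mixture.\<close>
  have eq: "Pi_pmf ?Z None ?p = Pi_pmf ?Z None (\<lambda>_. bernoulli_pmf (p_thr \<alpha> \<tau>) \<bind>
      (\<lambda>b. if b then map_pmf Some (value_pmf \<alpha> \<tau>) else return_pmf None))"
    by (rule Pi_pmf_cong) (auto simp: threshold_entry_zero[OF assms(2-4)])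
  have zero: "map_pmf Map.graph (Pi_pmf ?Z None ?p) =
    do {
      k \<leftarrow> binomial_pmf (m - n) (p_thr \<alpha> \<tau>);
      L \<leftarrow> pmf_of_set {L. L \<subseteq> ?Z \<and> card L = k};
      v \<leftarrow> Pi_pmf L 0 (\<lambda>_. value_pmf \<alpha> \<tau>);
      return_pmf {(i, v i) | i. i \<in> L}
    }"
    by (subst eq, subst card[symmetric],
        rule graph_Pi_pmf_bernoulli_mixture[OF _ p_thr_bounds[OF assms(2-4)]]) simp
  have "laborious_threshold \<alpha> \<tau> m M = map_pmf Map.graph (Pi_pmf (?A \<union> ?Z) None ?p)"
    unfolding laborious_threshold_def
    by (subst threshold_sample_eq_graph, simp, subst split) (rule refl)
  also have "\<dots> = do {
      S \<leftarrow> map_pmf Map.graph (Pi_pmf ?A None ?p);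
      T \<leftarrow> map_pmf Map.graph (Pi_pmf ?Z None ?p);
      return_pmf (S \<union> T)
    }"
    by (rule graph_Pi_pmf_union) auto
  \<comment> \<open>The block over \<open>?A\<close> is the sampling of the non-zero entries, and
    \<open>zero\<close> turns the block over \<open>?Z\<close> into the binomial draw, the uniform
    choice of locations and the values.\<close>
  also have "\<dots> = threshold_algorithm \<alpha> \<tau> m n M"
    unfolding threshold_algorithm_def zero
    by (simp add: threshold_sample_eq_graph bind_assoc_pmf bind_return_pmf)
  finally show ?thesis by (rule sym)
qed

end
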